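(* Let $F=(V,E)$ be a public graph topology with $n$ vertices and $m$ edges such that $d_{\max}(F)\ge 8$ and $\phi(F)\ge\max\{8n,\ 10000\, d_{\max}(F)\log_2 n\}$. Then for any $0<\epsilon\le1$ and $0\le\delta\le\frac{0.01\,\epsilon}{m}$, there is no $(\epsilon,\delta)$-differentially private (under the $\ell_1$ neighboring relation on weights) algorithm for hierarchical clustering on $F$ with expected additive error (with respect to Dasgupta's cost) less than $\frac{n\,\phi(F)}{400\,\epsilon\, d_{\max}(F)}$.
   Context: Graphs are finite, simple, undirected and connected, with $m>n$; the topology is public and only the edge weights $w:E\to\mathbb{R}_{\ge0}$ are private. $d_{\max}(F)$ is the maximum degree of $F$. A balanced cut is a partition $V=A\sqcup B$ with $\frac n3\le|A|,|B|\le\frac{2n}3$; $\phi(F)$ is the minimum, over balanced cuts, of the number of edges of $F$ between $A$ and $B$. A hierarchical clustering is a rooted binary tree $T$ whose leaves are in bijection with $V$. Its (Dasgupta) cost is $\mathrm{cost}_w(T)=\sum_{\{u,v\}\in E}|T[u\vee v]|\,w(\{u,v\})$, where $|T[u\vee v]|$ is the number of leaves in the subtree rooted at the lowest common ancestor of $u$ and $v$. A randomized hierarchical clustering algorithm $\mathcal{A}$ takes $(F,w)$ and outputs such a tree $T$; it has expected additive error at most $\eta$ if $\mathbb{E}[\mathrm{cost}_w(T)]\le\min_{T'}\mathrm{cost}_w(T')+\eta$ for every $w$. Two weight functions $w,w'$ on $E$ are neighboring if $\|w-w'\|_1\le 1$. $\mathcal{A}$ is $(\epsilon,\delta)$-differentially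 private if for all neighboring $w,w'$ and all sets $Y$ of outputs, $\Pr[\mathcal{A}(F,w)\in Y]\le e^{\epsilon}\Pr[\mathcal{A}(F,w')\in Y]+\delta$. *)

theory Defs
  imports "HOL-Probability.Probability_Mass_Function" "HOL-Library.FuncSet"
begin

text \<open>A graph is given by its vertex set \<open>V\<close> and its edge set \<open>E\<close>, an edge being the
  two-element set of its endpoints.\<close>

definition connected_simple_graph :: "'v set \<Rightarrow> 'v set set \<Rightarrow> bool" where
  "connected_simple_graph V E \<longleftrightarrow>
     finite V \<and> V \<noteq> {} \<and>
     (\<forall>e\<in>E. e \<subseteq> V \<and> card e = 2) \<and>
     (\<forall>u\<in>V. \<forall>v\<in>V. (u, v) \<in> {(x, y). {x, y} \<in> E}\<^sup>*)"

definition degree :: "'v set set \<Rightarrow> 'v \<Rightarrow> nat" where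
  "degree E v = card {e \<in> E. v \<in> e}"

definition max_degree :: "'v set \<Rightarrow> 'v set set \<Rightarrow> nat" where
  "max_degree V E = Max (degree E ` V)"

definition balanced_cuts :: "'v set \<Rightarrow> ('v set \<times> 'v set) set" where
  "balanced_cuts V = {(A, B). A \<union> B = V \<and> A \<inter> B = {} \<and>
     real (card V) / 3 \<le> real (card A) \<and> real (card A) \<le> 2 * real (card V) / 3 \<and>
     real (card V) / 3 \<le> real (card B) \<and> real (card B) \<le> 2 * real (card V) / 3}"

definition edges_between :: "'v set set \<Rightarrow> 'v set \<Rightarrow> 'v set \<Rightarrow> 'v set set" where
  "edges_between E A B = {e \<in> E. \<exists>a\<in>A. \<exists>b\<in>B. e = {a, b}}"

text \<open>The minimum below is only meaningful if a balanced cut exists, which is the case as soon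
  as there are at least two vertices.\<close>

definition min_balanced_cut :: "'v set \<Rightarrow> 'v set set \<Rightarrow> nat" where
  "min_balanced_cut V E = Min ((\<lambda>(A, B). card (edges_between E A B)) ` balanced_cuts V)"

datatype 'v hctree = Leaf 'v | Node "'v hctree" "'v hctree"

fun leaf_list :: "'v hctree \<Rightarrow> 'v list" where
  "leaf_list (Leaf v) = [v]"
| "leaf_list (Node l r) = leaf_list l @ leaf_list r"

definition hierarchical_clusterings :: "'v set \<Rightarrow> 'v hctree set" where
  "hierarchical_clusterings V = {T. distinct (leaf_list T) \<and> set (leaf_list T) = V}"

text \<open>The subtree rooted at the lowest common ancestor of the leaves in \<open>S\<close>; it is used with
  \<open>S = {u, v}\<close> an edge whose endpoints are leaves of the tree.\<close>

fun lca_subtree :: "'v hctree \<Rightarrow> 'v set \<Rightarrow> 'v hctree" where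
  "lca_subtree (Leaf v) S = Leaf v"
| "lca_subtree (Node l r) S =
     (if S \<subseteq> set (leaf_list l) then lca_subtree l S
      else if S \<subseteq> set (leaf_list r) then lca_subtree r S
      else Node l r)"

definition dasgupta_cost :: "'v set set \<Rightarrow> ('v set \<Rightarrow> real) \<Rightarrow> 'v hctree \<Rightarrow> real" where
  "dasgupta_cost E w T = (\<Sum>e\<in>E. real (length (leaf_list (lca_subtree T e))) * w e)"

text \<open>Weight functions are extensional, so that they are determined by their values on \<open>E\<close>
  and an algorithm cannot depend on anything else.\<close>

definition weight_functions :: "'v set set \<Rightarrow> ('v set \<Rightarrow> real) set" where
  "weight_functions E = (E \<rightarrow>\<^sub>E {0..})"

definition neighboring :: "'v set set \<Rightarrow> ('v set \<Rightarrow> real) \<Rightarrow> ('v set \<Rightarrow> real) \<Rightarrow> bool" where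
  "neighboring E w w' \<longleftrightarrow> (\<Sum>e\<in>E. \<bar>w e - w' e\<bar>) \<le> 1"

text \<open>Since the topology is public, a randomized algorithm is modelled, for a fixed graph, as a map
  from weight functions to distributions over the finitely many hierarchical clusterings.\<close>

definition hc_algorithm ::
    "'v set \<Rightarrow> 'v set set \<Rightarrow> (('v set \<Rightarrow> real) \<Rightarrow> 'v hctree pmf) \<Rightarrow> bool" where
  "hc_algorithm V E \<A> \<longleftrightarrow>
     (\<forall>w\<in>weight_functions E. set_pmf (\<A> w) \<subseteq> hierarchical_clusterings V)"

definition differentially_private ::
    "real \<Rightarrow> real \<Rightarrow> 'v set set \<Rightarrow> (('v set \<Rightarrow> real) \<Rightarrow> 'b pmf) \<Rightarrow> bool" where
  "differentially_private \<epsilon> \<delta> E \<A> \<longleftrightarrow>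
     (\<forall>w\<in>weight_functions E. \<forall>w'\<in>weight_functions E. neighboring E w w' \<longrightarrow>
        (\<forall>Y. measure_pmf.prob (\<A> w) Y \<le> exp \<epsilon> * measure_pmf.prob (\<A> w') Y + \<delta>))"

definition expected_additive_error_le ::
    "'v set \<Rightarrow> 'v set set \<Rightarrow> (('v set \<Rightarrow> real) \<Rightarrow> 'v hctree pmf) \<Rightarrow> real \<Rightarrow> bool" where
  "expected_additive_error_le V E \<A> \<eta> \<longleftrightarrow>
     (\<forall>w\<in>weight_functions E.
        measure_pmf.expectation (\<A> w) (dasgupta_cost E w)
          \<le> Min (dasgupta_cost E w ` hierarchical_clusterings V) + \<eta>)"

lemma leaf_list_not_Nil: "leaf_list T \<noteq> []"
  by (induction T) auto

lemma finite_hctrees_leaf_list: "finite {T. leaf_list T = xs}"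
proof (induction xs rule: length_induct)
  case (1 xs)
  let ?P = "\<Union>i\<in>{0<..<length xs}.
    {T. leaf_list T = take i xs} \<times> {T. leaf_list T = drop i xs}"
  have fin: "finite ?P"
    using 1 by auto
  have "T \<in> Leaf ` set xs \<union> (\<lambda>(l, r). Node l r) ` ?P" if T: "leaf_list T = xs" for T
  proof (cases T)
    case (Leaf v)
    then show ?thesis using T by auto
  next
    case (Node l r)
    have "length (leaf_list l) \<in> {0<..<length xs}"
      using T Node leaf_list_not_Nil[of l] leaf_list_not_Nil[of r] by auto
    moreover have "leaf_list l = take (length (leaf_list l)) xs"
      "leaf_list r = drop (length (leaf_list l)) xs"
      using T Node by auto
    ultimately have "(l, r) \<in> ?P" by blast
    then show ?thesis using Node by blast
  qed
  then have "{T. leaf_list T = xs} \<subseteq> Leaf ` set xs \<union> (\<lambda>(l, r). Node l r) ` ?P" by blast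
  then show ?case
    using fin by (meson List.finite_set finite_UnI finite_imageI finite_subset)
qed

text \<open>The minimum over hierarchical clusterings ranges over a finite nonempty set.\<close>

lemma finite_hierarchical_clusterings:
  assumes "finite V"
  shows "finite (hierarchical_clusterings V)"
proof -
  have "hierarchical_clusterings V =
      (\<Union>xs\<in>{xs. set xs = V \<and> distinct xs}. {T. leaf_list T = xs})"
    by (auto simp: hierarchical_clusterings_def)
  moreover have "finite {xs. set xs = V \<and> distinct xs}"
    using assms by (rule finite_subset[OF _ finite_subset_distinct, rotated]) auto
  ultimately show ?thesis by (simp add: finite_hctrees_leaf_list)
qed

lemma hierarchical_clusterings_nonempty:
  assumes "finite V" "V \<noteq> {}"
  shows "hierarchical_clusterings V \<noteq> {}"
proof -
  have *: "\<exists>T. leaf_list T = xs" if "xs \<noteq> []" for xs :: "'a list"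
    using that
  proof (induction xs rule: list_nonempty_induct)
    case (single x)
    show ?case by (rule exI[of _ "Leaf x"]) simp
  next
    case (cons x xs)
    then obtain T where "leaf_list T = xs" by blast
    then show ?case by (intro exI[of _ "Node (Leaf x) T"]) simp
  qed
  obtain xs where xs: "set xs = V" "distinct xs"
    using assms(1) finite_distinct_list by blast
  then have "xs \<noteq> []" using assms(2) by auto
  with * obtain T where "leaf_list T = xs" by blast
  then show ?thesis using xs by (auto simp: hierarchical_clusterings_def)
qed

end

theory Submission
  imports Defs
begin

text \<open>Put weight \<open>k \<approx> 1 / \<epsilon>\<close> on a random edge set \<open>S\<close> that contains each edge independently
  with odds \<open>x = 1 / (2 d\<^sub>m\<^sub>a\<^sub>x)\<close>, and \<open>0\<close> elsewhere. By group privacy, adding one edge to \<open>S\<close>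
  changes the output distribution by about a factor of \<open>exp 1\<close>, so the output cannot tell the edges of
  \<open>S\<close> from the others and pays on \<open>S\<close> at least about a fraction \<open>x / exp 1\<close> of
  \<open>k \<Sum>e\<in>E. |T[e]|\<close>. Cutting off the lowest heavy subtree of \<open>T\<close> gives a balanced cut, each of whose
  edges has \<open>|T[e]| \<ge> 2n / 3\<close>; hence the expected cost is of order \<open>n \<phi> / (\<epsilon> d\<^sub>m\<^sub>a\<^sub>x)\<close>. On the
  other hand the percolation is subcritical, so components of \<open>S\<close> have bounded mean size, and
  clustering component by component costs only \<open>O(n / \<epsilon>)\<close> in expectation.\<close>

section \<open>Weighted sums over subsets\<close>

text \<open>Normalising constant of the percolation measure: weighting \<open>S\<close> by
  \<open>x ^ card S\<close> makes each edge present independently with odds \<open>x\<close>.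
  Averages over random edge sets stay in this unnormalised form throughout.\<close>

lemma sum_power_card_Pow:
  fixes x :: real
  assumes "finite F"
  shows "(\<Sum>S\<in>Pow F. x ^ card S) = (1 + x) ^ card F"
  using assms
proof (induction F)
  case empty
  then show ?case by simp
next
  case (insert e F)
  have "(\<Sum>S\<in>insert e ` Pow F. x ^ card S) = (\<Sum>S\<in>Pow F. x ^ card (insert e S))"
    using insert.hyps by (intro sum.reindex_cong[OF _ refl refl]) (auto simp: inj_on_def)
  also have "\<dots> = (\<Sum>S\<in>Pow F. x * x ^ card S)"
    using insert.hyps by (intro sum.cong refl) (auto simp: card_insert_if finite_subset)
  finally have *: "(\<Sum>S\<in>insert e ` Pow F. x ^ card S) = x * (1 + x) ^ card F"
    using insert by (simp flip: sum_distrib_left)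
  have "(\<Sum>S\<in>Pow (insert e F). x ^ card S) =
      (\<Sum>S\<in>Pow F. x ^ card S) + (\<Sum>S\<in>insert e ` Pow F. x ^ card S)"
    unfolding Pow_insert using insert.hyps by (intro sum.union_disjoint) auto
  then show ?case using * insert by (simp add: algebra_simps)
qed

text \<open>Removing the marked element is a bijection from the pairs with \<open>e \<in> S\<close>
  onto the pairs with \<open>S \<subseteq> F - {e}\<close>, and it costs one factor
  \<open>x\<close>. It serves to resample the state of a single edge.\<close>

lemma sum_Pow_marked:
  fixes x :: real
  assumes "finite F"
  shows "(\<Sum>S\<in>Pow F. \<Sum>e\<in>S. x ^ card S * g S e) =
    x * (\<Sum>e\<in>F. \<Sum>S\<in>Pow (F - {e}). x ^ card S * g (insert e S) e)"
proof -
  have "(\<Sum>S\<in>Pow F. \<Sum>e\<in>S. x ^ card S * g S e) =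
      (\<Sum>S\<in>Pow F. \<Sum>e\<in>{e\<in>F. e \<in> S}. x ^ card S * g S e)"
    by (intro sum.cong refl) auto
  also have "\<dots> = (\<Sum>e\<in>F. \<Sum>S\<in>{S\<in>Pow F. e \<in> S}. x ^ card S * g S e)"
    using assms by (intro sum.swap_restrict) auto
  also have "\<dots> = (\<Sum>e\<in>F. \<Sum>S\<in>Pow (F - {e}). x ^ card (insert e S) * g (insert e S) e)"
  proof (rule sum.cong[OF refl], rule sum.reindex_cong[where l = "insert e" for e])
    fix e assume e: "e \<in> F"
    show "inj_on (insert e) (Pow (F - {e}))" by (auto simp: inj_on_def)
    have "S \<in> insert e ` Pow (F - {e})" if "S \<subseteq> F" "e \<in> S" for S
      using that by (intro image_eqI[of _ _ "S - {e}"]) auto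
    then show "{S\<in>Pow F. e \<in> S} = insert e ` Pow (F - {e})" using e by auto
  qed auto
  also have "\<dots> = (\<Sum>e\<in>F. \<Sum>S\<in>Pow (F - {e}). x * (x ^ card S * g (insert e S) e))"
  proof (intro sum.cong refl)
    fix e S assume "S \<in> Pow (F - {e})"
    then have "card (insert e S) = Suc (card S)"
      using assms by (subst card_insert_disjoint) (auto intro: finite_subset)
    then show "x ^ card (insert e S) * g (insert e S) e = x * (x ^ card S * g (insert e S) e)"
      by simp
  qed
  finally show ?thesis by (simp add: sum_distrib_left)
qed

lemma sum_Pow_unmarked:
  fixes x :: real
  assumes "finite F"
  shows "(\<Sum>S\<in>Pow F. \<Sum>e\<in>F. x ^ card S * g S e) =
    (\<Sum>S\<in>Pow F. \<Sum>e\<in>S. x ^ card S * g S e) +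
    (\<Sum>e\<in>F. \<Sum>S\<in>Pow (F - {e}). x ^ card S * g S e)"
proof -
  have "(\<Sum>S\<in>Pow F. \<Sum>e\<in>F. x ^ card S * g S e) =
      (\<Sum>S\<in>Pow F. (\<Sum>e\<in>S. x ^ card S * g S e) + (\<Sum>e\<in>{e\<in>F. e \<notin> S}. x ^ card S * g S e))"
    using assms
    by (intro sum.cong refl) (subst sum.union_disjoint[symmetric]; auto intro: finite_subset intro!: sum.cong)
  also have "(\<Sum>S\<in>Pow F. \<Sum>e\<in>{e\<in>F. e \<notin> S}. x ^ card S * g S e) =
      (\<Sum>e\<in>F. \<Sum>S\<in>{S\<in>Pow F. e \<notin> S}. x ^ card S * g S e)"
    using assms by (intro sum.swap_restrict) auto
  moreover have "{S\<in>Pow F. e \<notin> S} = Pow (F - {e})" for e by auto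
  ultimately show ?thesis by (simp add: sum.distrib)
qed

text \<open>Each pair with \<open>e \<notin> S\<close> is compared by \<open>step\<close> with the
  pair in which \<open>e\<close> has been inserted. By \<open>sum_Pow_marked\<close> the inserted
  pairs add up to \<open>1 / x\<close> times the marked sum, so the marked and unmarked pairs
  together give the factor \<open>1 + c / x\<close>. In the application \<open>f S e\<close> is the
  expected size of the subtree that separates \<open>e\<close>.\<close>

lemma sum_marked_lower_bound:
  fixes x c \<beta> L :: real
  assumes F: "finite F" and x: "0 < x" and \<beta>: "0 \<le> \<beta>"
    and step: "\<And>S e. S \<subseteq> F \<Longrightarrow> e \<in> F - S \<Longrightarrow> f S e \<le> c * f (insert e S) e + \<beta>"
    and total: "\<And>S. S \<subseteq> F \<Longrightarrow> L \<le> (\<Sum>e\<in>F. f S e)"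
  shows "(L - card F * \<beta>) * (1 + x) ^ card F
    \<le> (1 + c / x) * (\<Sum>S\<in>Pow F. \<Sum>e\<in>S. x ^ card S * f S e)" (is "_ \<le> _ * ?B")
proof -
  have "L * (1 + x) ^ card F = (\<Sum>S\<in>Pow F. x ^ card S * L)"
    using F by (simp add: sum_power_card_Pow flip: sum_distrib_right)
  also have "\<dots> \<le> (\<Sum>S\<in>Pow F. x ^ card S * (\<Sum>e\<in>F. f S e))"
    using total x by (intro sum_mono mult_left_mono) auto
  also have "\<dots> = ?B + (\<Sum>e\<in>F. \<Sum>S\<in>Pow (F - {e}). x ^ card S * f S e)"
    using sum_Pow_unmarked[OF F, of x f] by (simp add: sum_distrib_left)
  finally have 1: "L * (1 + x) ^ card F \<le> \<dots>" .
  have "(\<Sum>e\<in>F. \<Sum>S\<in>Pow (F - {e}). x ^ card S * f S e) \<le>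
      (\<Sum>e\<in>F. \<Sum>S\<in>Pow (F - {e}). x ^ card S * (c * f (insert e S) e + \<beta>))"
    using step x by (intro sum_mono mult_left_mono) auto
  also have "\<dots> = c * (\<Sum>e\<in>F. \<Sum>S\<in>Pow (F - {e}). x ^ card S * f (insert e S) e) +
      \<beta> * (\<Sum>e\<in>F. (1 + x) ^ card (F - {e}))"
    unfolding sum_power_card_Pow[OF finite_Diff[OF F], symmetric]
    by (simp only: sum_distrib_left sum.distrib distrib_left mult.left_commute mult.commute)
  also have "(\<Sum>e\<in>F. \<Sum>S\<in>Pow (F - {e}). x ^ card S * f (insert e S) e) = ?B / x"
    using sum_Pow_marked[OF F, of x f] x by simp
  also have "(\<Sum>e\<in>F. (1 + x) ^ card (F - {e})) \<le> (\<Sum>e\<in>F. (1 + x) ^ card F)"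
    using F x by (intro sum_mono power_increasing card_mono) auto
  finally have 2: "(\<Sum>e\<in>F. \<Sum>S\<in>Pow (F - {e}). x ^ card S * f S e) \<le>
      c * (?B / x) + \<beta> * (\<Sum>e\<in>F. (1 + x) ^ card F)"
    using \<beta> by (simp add: mult_left_mono)
  have "(L - card F * \<beta>) * (1 + x) ^ card F =
      L * (1 + x) ^ card F - \<beta> * (\<Sum>e\<in>F. (1 + x) ^ card F)"
    by (simp add: algebra_simps)
  also have "\<dots> \<le> ?B + c * (?B / x)" using 1 2 by linarith
  also have "\<dots> = (1 + c / x) * ?B" by (simp add: algebra_simps)
  finally show ?thesis .
qed

section \<open>Mean component size\<close>

definition component :: "'v set set \<Rightarrow> 'v \<Rightarrow> 'v set" where
  "component S u = {v. (u, v) \<in> {(x, y). {x, y} \<in> S}\<^sup>*}"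

lemma self_in_component [simp]: "u \<in> component S u"
  by (simp add: component_def)

lemma component_step: "v \<in> component S u \<Longrightarrow> {v, w} \<in> S \<Longrightarrow> w \<in> component S u"
  unfolding component_def by (auto intro: rtrancl_into_rtrancl)

lemma component_induct [consumes 1, case_names base step]:
  assumes "v \<in> component S u" "P u"
    "\<And>v w. v \<in> component S u \<Longrightarrow> {v, w} \<in> S \<Longrightarrow> P v \<Longrightarrow> P w"
  shows "P v"
proof -
  have "(u, v) \<in> {(x, y). {x, y} \<in> S}\<^sup>*" using assms(1) by (simp add: component_def)
  then show ?thesis
    by (induction rule: rtrancl_induct) (use assms(2,3) in \<open>auto simp: component_def\<close>)
qed

lemma component_subset: "\<Union>S \<subseteq> V \<Longrightarrow> u \<in> V \<Longrightarrow> component S u \<subseteq> V"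
proof
  fix v assume "\<Union>S \<subseteq> V" "u \<in> V" "v \<in> component S u"
  from this(3,1,2) show "v \<in> V" by (induction rule: component_induct) auto
qed

lemma component_eqI:
  assumes "v \<in> component S u"
  shows "component S v = component S u"
proof -
  have "sym {(x, y). {x, y} \<in> S}" by (auto simp: sym_def insert_commute)
  then have "sym ({(x, y). {x, y} \<in> S}\<^sup>*)" by (rule sym_rtrancl)
  then show ?thesis using assms unfolding component_def
    by (auto dest: symD intro: rtrancl_trans)
qed

text \<open>A path that leaves \<open>u\<close> for the last time does not use its first edge again.\<close>

lemma component_subset_neighbours:
  "component S u \<subseteq> {u} \<union> (\<Union>e\<in>{e\<in>S. u \<in> e}. \<Union>v\<in>{v. e = {u, v}}. component (S - {e}) v)"
  (is "_ \<subseteq> ?R")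
proof
  fix v assume "v \<in> component S u"
  then show "v \<in> ?R"
  proof (induction rule: component_induct)
    case base
    then show ?case by simp
  next
    case (step v w)
    show ?case
    proof (cases "v = u \<or> w = u")
      case True
      then show ?thesis
      proof
        assume "v = u"
        then show ?thesis
          using step.hyps by (intro UnI2 UN_I[of "{u, w}"]) auto
      qed simp
    next
      case False
      then obtain e z where e: "e \<in> S" "e = {u, z}" "v \<in> component (S - {e}) z"
        using step.IH by blast
      \<comment> \<open>Neither \<open>v\<close> nor \<open>w\<close> is \<open>u\<close>, so the
        new edge differs from \<open>e\<close>, and the path continues without
        \<open>e\<close>.\<close>
      moreover have "{v, w} \<in> S - {e}" using False e step.hyps by auto
      ultimately have "w \<in> component (S - {e}) z" using component_step by metis
      then show ?thesis using e by blast
    qed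
  qed
qed

text \<open>The union on the right is closed under steps along \<open>S\<close>, and also under the
  new edge, since it contains both ends.\<close>

lemma component_insert_subset:
  "component (insert {u, v} S) u \<subseteq> component S u \<union> component S v"
proof
  fix w assume "w \<in> component (insert {u, v} S) u"
  then show "w \<in> component S u \<union> component S v"
  proof (induction rule: component_induct)
    case base
    then show ?case by simp
  next
    case (step w w')
    then show ?case by (auto simp: doubleton_eq_iff intro: component_step)
  qed
qed

lemma card_2_memberE:
  assumes "card e = 2" "u \<in> e"
  obtains v where "e = {u, v}" "v \<noteq> u"
  using assms unfolding card_2_iff by (metis insertE insert_commute singletonD)

text \<open>Branching argument by induction on the number of edges. The component of
  \<open>u\<close> is covered by \<open>u\<close> and, for each chosen edge
  \<open>e = {u, v}\<close>, the component of \<open>v\<close> without \<open>e\<close>. At most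
  \<open>d\<close> edges meet \<open>u\<close>, each has odds \<open>x\<close>, and each contributes
  at most \<open>K\<close> by induction, so any \<open>K\<close> with
  \<open>1 + x * d * K \<le> K\<close> is a bound on the mean.\<close>

lemma mean_card_component_le:
  fixes x K :: real and d :: nat
  assumes "finite F" "\<Union>F \<subseteq> V" "finite V" "u \<in> V"
    and "\<And>e. e \<in> F \<Longrightarrow> card e = 2"
    and "\<And>v. v \<in> V \<Longrightarrow> card {e\<in>F. v \<in> e} \<le> d"
    and x: "0 \<le> x" and K: "0 \<le> K" "1 + x * d * K \<le> K"
  shows "(\<Sum>S\<in>Pow F. x ^ card S * card (component S u)) \<le> K * (1 + x) ^ card F"
  using assms(1-6)
proof (induction "card F" arbitrary: F u rule: less_induct)
  case less
  \<comment> \<open>The \<open>THE\<close> term is the other end of \<open>e\<close>. The value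
    \<open>0\<close> away from \<open>u\<close> lets the sum run over all of \<open>S\<close>, as
    \<open>sum_Pow_marked\<close> requires.\<close>
  define h where "h S e = (if u \<in> e then card (component (S - {e}) (THE v. e = {u, v})) else 0)"
    for S e
  have the: "(THE v. e = {u, v}) = v" if "e = {u, v}" for e v
    using that by (auto simp: doubleton_eq_iff)
  have fin: "finite S" if "S \<subseteq> F" for S using that less.prems(1) finite_subset by auto
  have pt: "card (component S u) \<le> 1 + (\<Sum>e\<in>S. h S e)" if S: "S \<subseteq> F" for S
  proof -
    let ?N = "{e\<in>S. u \<in> e}"
    have "component S u \<subseteq> {u} \<union> (\<Union>e\<in>?N. component (S - {e}) (THE v. e = {u, v}))"
    proof (rule order_trans[OF component_subset_neighbours], intro Un_mono UN_mono order_refl)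
      fix e assume "e \<in> ?N"
      show "(\<Union>v\<in>{v. e = {u, v}}. component (S - {e}) v)
          \<subseteq> component (S - {e}) (THE v. e = {u, v})"
        using the by auto
    qed
    moreover have sub: "component (S - {e}) (THE v. e = {u, v}) \<subseteq> V" if "e \<in> ?N" for e
    proof -
      have "card e = 2" "u \<in> e" using that S less.prems(5) by auto
      then obtain v where v: "e = {u, v}" by (rule card_2_memberE)
      then have "v \<in> V" using that S less.prems(2) by auto
      then show ?thesis unfolding the[OF v] using S less.prems(2) by (intro component_subset) auto
    qed
    moreover have "finite (\<Union>e\<in>?N. component (S - {e}) (THE v. e = {u, v}))"
      using fin[OF S] sub less.prems(3) by (auto intro: finite_subset)
    ultimately have "card (component S u) \<le>
        card ({u} \<union> (\<Union>e\<in>?N. component (S - {e}) (THE v. e = {u, v})))"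
      by (intro card_mono) auto
    also have "\<dots> \<le> card {u} + card (\<Union>e\<in>?N. component (S - {e}) (THE v. e = {u, v}))"
      by (rule card_Un_le)
    also have "\<dots> \<le> 1 + (\<Sum>e\<in>?N. card (component (S - {e}) (THE v. e = {u, v})))"
      using fin[OF S] by (simp add: card_UN_le)
    also have "(\<Sum>e\<in>?N. card (component (S - {e}) (THE v. e = {u, v}))) = (\<Sum>e\<in>S. h S e)"
      using fin[OF S] by (simp add: h_def sum.If_cases Collect_conj_eq Int_commute)
    finally show ?thesis .
  qed
  have inner: "(\<Sum>S\<in>Pow (F - {e}). x ^ card S * real (h (insert e S) e)) \<le>
      (if u \<in> e then K * (1 + x) ^ card F else 0)" if e: "e \<in> F" for e
  proof (cases "u \<in> e")
    case True
    obtain v where v: "e = {u, v}" using card_2_memberE[OF less.prems(5)[OF e] True] .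
    \<comment> \<open>Since \<open>S\<close> avoids \<open>e\<close>, deleting \<open>e\<close> from
      \<open>insert e S\<close> gives \<open>S\<close> back. The sum is thus a mean component size
      for the smaller edge set \<open>F - {e}\<close>.\<close>
    have "(\<Sum>S\<in>Pow (F - {e}). x ^ card S * real (h (insert e S) e)) =
        (\<Sum>S\<in>Pow (F - {e}). x ^ card S * card (component S v))"
      using the[OF v] True by (intro sum.cong refl) (auto simp: h_def Diff_insert_absorb subset_Diff_insert)
    also have "\<dots> \<le> K * (1 + x) ^ card (F - {e})"
    proof (rule less.hyps)
      show "card (F - {e}) < card F" using e less.prems(1) by (meson card_Diff1_less)
      show "v \<in> V" using v e less.prems(2) by auto
      show "card {f \<in> F - {e}. z \<in> f} \<le> d" if "z \<in> V" for z
      proof -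
        have "card {f \<in> F - {e}. z \<in> f} \<le> card {f \<in> F. z \<in> f}"
          using less.prems(1) by (intro card_mono) auto
        then show ?thesis using less.prems(6)[OF that] by linarith
      qed
    qed (use less.prems in auto)
    also have "\<dots> \<le> K * (1 + x) ^ card F"
      using x K less.prems(1) by (intro mult_left_mono power_increasing card_mono) auto
    finally show ?thesis using True by simp
  qed (simp add: h_def)
  have "(\<Sum>S\<in>Pow F. x ^ card S * card (component S u)) \<le>
      (\<Sum>S\<in>Pow F. x ^ card S * (1 + (\<Sum>e\<in>S. real (h S e))))"
  proof (intro sum_mono mult_left_mono)
    fix S assume "S \<in> Pow F"
    then have "real (card (component S u)) \<le> real (1 + (\<Sum>e\<in>S. h S e))"
      using pt by (intro of_nat_mono) auto
    then show "real (card (component S u)) \<le> 1 + (\<Sum>e\<in>S. real (h S e))" by simp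
  qed (use x in auto)
  also have "\<dots> = (1 + x) ^ card F + (\<Sum>S\<in>Pow F. \<Sum>e\<in>S. x ^ card S * real (h S e))"
    using less.prems(1) by (simp add: sum_power_card_Pow[symmetric] sum.distrib algebra_simps sum_distrib_left)
  also have "(\<Sum>S\<in>Pow F. \<Sum>e\<in>S. x ^ card S * real (h S e)) =
      x * (\<Sum>e\<in>F. \<Sum>S\<in>Pow (F - {e}). x ^ card S * real (h (insert e S) e))"
    by (rule sum_Pow_marked[OF less.prems(1)])
  also have "\<dots> \<le> x * (\<Sum>e\<in>F. (if u \<in> e then K * (1 + x) ^ card F else 0))"
    using x inner by (intro mult_left_mono sum_mono) auto
  also have "\<dots> = x * (card {e\<in>F. u \<in> e} * (K * (1 + x) ^ card F))"
    using less.prems(1) by (simp add: sum.If_cases Collect_conj_eq)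
  also have "\<dots> \<le> x * (d * (K * (1 + x) ^ card F))"
    using x K less.prems(4,6) by (intro mult_left_mono mult_right_mono) auto
  also have "(1 + x) ^ card F + \<dots> = (1 + x * d * K) * (1 + x) ^ card F"
    by (simp add: algebra_simps)
  also have "\<dots> \<le> K * (1 + x) ^ card F"
    using x K by (intro mult_right_mono) auto
  finally show ?case by simp
qed

section \<open>Hierarchical clusterings\<close>

lemma length_lca_subtree_le: "length (leaf_list (lca_subtree T e)) \<le> length (leaf_list T)"
  by (induction T) auto

lemma length_leaf_list:
  "T \<in> hierarchical_clusterings V \<Longrightarrow> length (leaf_list T) = card V"
  by (auto simp: hierarchical_clusterings_def distinct_card)

text \<open>Any trees on the blocks are strung together as a caterpillar. A nonempty set inside one
  block is then separated within the tree of that block.\<close>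

lemma hierarchical_clustering_of_partition:
  assumes "finite \<C>" "\<C> \<noteq> {}" "\<And>C. C \<in> \<C> \<Longrightarrow> finite C \<and> C \<noteq> {}" "disjoint \<C>"
  shows "\<exists>T\<in>hierarchical_clusterings (\<Union>\<C>). \<forall>C\<in>\<C>. \<forall>e. e \<noteq> {} \<and> e \<subseteq> C \<longrightarrow>
    length (leaf_list (lca_subtree T e)) \<le> card C"
  using assms
proof (induction \<C> rule: finite_ne_induct)
  case (singleton C)
  then obtain T where T: "T \<in> hierarchical_clusterings C"
    using hierarchical_clusterings_nonempty by blast
  then show ?case
    using length_lca_subtree_le[of T] by (auto simp: length_leaf_list intro!: bexI[of _ T])
next
  case (insert C \<C>)
  obtain R where R: "R \<in> hierarchical_clusterings (\<Union>\<C>)"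
    "\<And>D e. D \<in> \<C> \<Longrightarrow> e \<noteq> {} \<Longrightarrow> e \<subseteq> D \<Longrightarrow> length (leaf_list (lca_subtree R e)) \<le> card D"
    using insert.IH insert.prems by (auto simp: pairwise_insert)
  obtain T where T: "T \<in> hierarchical_clusterings C"
    using hierarchical_clusterings_nonempty insert.prems by blast
  have disj: "C \<inter> \<Union>\<C> = {}"
    using insert.prems insert.hyps by (auto simp: pairwise_insert disjnt_def)
  show ?case
  proof (intro bexI ballI allI impI)
    show "Node T R \<in> hierarchical_clusterings (\<Union>(insert C \<C>))"
      using T R disj by (auto simp: hierarchical_clusterings_def)
    fix D e assume D: "D \<in> insert C \<C>" "e \<noteq> {} \<and> e \<subseteq> D"
    have sets: "set (leaf_list T) = C" "set (leaf_list R) = \<Union>\<C>"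
      using T R by (auto simp: hierarchical_clusterings_def)
    show "length (leaf_list (lca_subtree (Node T R) e)) \<le> card D"
    proof (cases "D = C")
      case True
      then show ?thesis
        using D sets length_lca_subtree_le[of T e] by (simp add: length_leaf_list[OF T])
    next
      case False
      then have "D \<in> \<C>" using D by auto
      \<comment> \<open>As \<open>e\<close> is nonempty and disjoint from \<open>C\<close>, the
        search for its lowest common ancestor descends into \<open>R\<close>.\<close>
      then have "\<not> e \<subseteq> C" "e \<subseteq> \<Union>\<C>" using D disj by auto
      then show ?thesis using R(2)[OF \<open>D \<in> \<C>\<close>] D sets by simp
    qed
  qed
qed

lemma hierarchical_clustering_of_components:
  assumes "finite V" "V \<noteq> {}" "\<Union>S \<subseteq> V"
  obtains T where "T \<in> hierarchical_clusterings V"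
    and "\<And>u v. u \<in> V \<Longrightarrow> {u, v} \<in> S \<Longrightarrow>
      length (leaf_list (lca_subtree T {u, v})) \<le> card (component S u)"
proof -
  let ?C = "component S ` V"
  have sub: "component S u \<subseteq> V" if "u \<in> V" for u using component_subset assms that by metis
  have "disjoint ?C"
  proof (rule disjointI)
    fix A B assume AB: "A \<in> ?C" "B \<in> ?C" "A \<noteq> B"
    then obtain u v where uv: "A = component S u" "B = component S v" by auto
    have "w \<notin> B" if "w \<in> A" for w
      using component_eqI[of w S u] component_eqI[of w S v] that AB(3) uv by auto
    then show "A \<inter> B = {}" by auto
  qed
  moreover have "finite C \<and> C \<noteq> {}" if "C \<in> ?C" for C
    using that sub assms(1) by (auto intro: finite_subset simp: component_def)
  moreover have "\<Union>?C = V" using sub by force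
  ultimately have "\<exists>T\<in>hierarchical_clusterings V. \<forall>C\<in>?C. \<forall>e. e \<noteq> {} \<and> e \<subseteq> C \<longrightarrow>
      length (leaf_list (lca_subtree T e)) \<le> card C"
    using hierarchical_clustering_of_partition[of ?C] assms(1,2) by simp
  then obtain T where T: "T \<in> hierarchical_clusterings V" "\<forall>C\<in>?C. \<forall>e. e \<noteq> {} \<and> e \<subseteq> C \<longrightarrow>
      length (leaf_list (lca_subtree T e)) \<le> card C"
    by (rule bexE)
  show ?thesis
  proof (rule that[OF T(1)])
    fix u v assume "u \<in> V" "{u, v} \<in> S"
    then show "length (leaf_list (lca_subtree T {u, v})) \<le> card (component S u)"
      using component_step[of u S u v] by (intro T(2)[rule_format]) auto
  qed
qed

text \<open>Descend to a child for as long as some child has more than \<open>2 * n / 3\<close>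
  leaves. Where this stops, both children have at most \<open>2 * n / 3\<close> leaves and the
  larger one has at least \<open>n / 3\<close>; its leaves form \<open>A\<close>. A set that meets
  \<open>A\<close> but is not inside it is separated at a node of the descent, all of which are
  heavy. The threshold \<open>n\<close> stays fixed while the tree shrinks.\<close>

lemma heavy_subtree:
  assumes "distinct (leaf_list T)" "2 * n / 3 < length (leaf_list T)" "(2 :: real) \<le> n"
  shows "\<exists>A\<subseteq>set (leaf_list T). n / 3 \<le> card A \<and> card A \<le> 2 * n / 3 \<and>
    (\<forall>e. e \<inter> A \<noteq> {} \<and> \<not> e \<subseteq> A \<longrightarrow> 2 * n / 3 \<le> length (leaf_list (lca_subtree T e)))"
  using assms(1,2)
proof (induction T)
  case (Leaf v)
  \<comment> \<open>A leaf is never heavy: \<open>2 * n / 3\<close> exceeds \<open>1\<close> once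
    \<open>n\<close> is at least \<open>2\<close>.\<close>
  then show ?case using assms(3) by simp
next
  case (Node l r)
  let ?L = "set (leaf_list l)" and ?R = "set (leaf_list r)"
  have disj: "?L \<inter> ?R = {}" and len: "length (leaf_list l) = card ?L" "length (leaf_list r) = card ?R"
    using Node.prems by (auto simp: distinct_card)
  \<comment> \<open>For \<open>A\<close> inside a child \<open>C\<close>, only sets
    \<open>e \<subseteq> C\<close> need checking: any other \<open>e\<close> meets \<open>C\<close>
    and leaves it, so it is separated at the current heavy node.\<close>
  have *: ?case if "A \<subseteq> C" "C = ?L \<or> C = ?R" "n / 3 \<le> card A" "card A \<le> 2 * n / 3"
    "\<And>e. e \<inter> A \<noteq> {} \<Longrightarrow> \<not> e \<subseteq> A \<Longrightarrow> e \<subseteq> C \<Longrightarrow>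
      2 * n / 3 \<le> length (leaf_list (lca_subtree (Node l r) e))" for A C
  proof (intro exI[of _ A] conjI allI impI)
    fix e assume e: "e \<inter> A \<noteq> {} \<and> \<not> e \<subseteq> A"
    show "2 * n / 3 \<le> length (leaf_list (lca_subtree (Node l r) e))"
    proof (cases "e \<subseteq> C")
      case False
      then have "\<not> e \<subseteq> ?L" "\<not> e \<subseteq> ?R" using that(1,2) e disj by blast+
      then show ?thesis using Node.prems(2) by simp
    qed (use that e in auto)
  qed (use that in auto)
  have lR: "lca_subtree (Node l r) e = lca_subtree r e" if "e \<noteq> {}" "e \<subseteq> ?R" for e
    using that disj by auto
  show ?case
  proof (cases "2 * n / 3 < card ?L")
    case True
    then obtain A where "A \<subseteq> ?L" "n / 3 \<le> card A" "card A \<le> 2 * n / 3"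
      "\<And>e. e \<inter> A \<noteq> {} \<Longrightarrow> \<not> e \<subseteq> A \<Longrightarrow> 2 * n / 3 \<le> length (leaf_list (lca_subtree l e))"
      using Node.IH(1) Node.prems(1) len by auto
    then show ?thesis by (intro *[of A ?L]) auto
  next
    case L: False
    show ?thesis
    proof (cases "2 * n / 3 < card ?R")
      case True
      then obtain A where "A \<subseteq> ?R" "n / 3 \<le> card A" "card A \<le> 2 * n / 3"
        "\<And>e. e \<inter> A \<noteq> {} \<Longrightarrow> \<not> e \<subseteq> A \<Longrightarrow> 2 * n / 3 \<le> length (leaf_list (lca_subtree r e))"
        using Node.IH(2) Node.prems(1) len by auto
      moreover have "2 * n / 3 \<le> length (leaf_list (lca_subtree (Node l r) e))"
        if "e \<inter> A \<noteq> {}" "\<not> e \<subseteq> A" "e \<subseteq> ?R" for e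
        using calculation(4)[OF that(1,2)] that lR[of e] by fastforce
      ultimately show ?thesis by (intro *[of A ?R]) blast+
    next
      case R: False
      have "n / 3 \<le> card ?L \<or> n / 3 \<le> card ?R"
        using Node.prems(2) len by simp linarith
      then show ?thesis
        using L R *[of ?L ?L] *[of ?R ?R] by (auto simp del: lca_subtree.simps)
    qed
  qed
qed

text \<open>The set \<open>A\<close> from \<open>heavy_subtree\<close> and its complement form a
  balanced cut. The edges across it alone suffice: each contributes at least two thirds of
  \<open>card V\<close>.\<close>

lemma sum_length_lca_subtree_ge:
  assumes V: "finite V" "2 \<le> card V" and E: "finite E" "\<And>e. e \<in> E \<Longrightarrow> e \<subseteq> V"
    and T: "T \<in> hierarchical_clusterings V"
  shows "2 / 3 * card V * min_balanced_cut V E \<le> (\<Sum>e\<in>E. length (leaf_list (lca_subtree T e)))"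
proof -
  have TV: "distinct (leaf_list T)" "set (leaf_list T) = V" "length (leaf_list T) = card V"
    using T length_leaf_list by (auto simp: hierarchical_clusterings_def)
  obtain A where A: "A \<subseteq> V" "card V / 3 \<le> card A" "card A \<le> 2 * card V / 3"
    and cut: "\<And>e. e \<inter> A \<noteq> {} \<Longrightarrow> \<not> e \<subseteq> A \<Longrightarrow> 2 * card V / 3 \<le> length (leaf_list (lca_subtree T e))"
    using heavy_subtree[of T "real (card V)"] TV V(2) by auto
  have "real (card (V - A)) = card V - card A"
    using A(1) V(1) by (simp add: card_Diff_subset finite_subset card_mono of_nat_diff)
  then have "(A, V - A) \<in> balanced_cuts V"
    using A unfolding balanced_cuts_def by auto
  moreover have "finite (balanced_cuts V)"
    by (rule finite_subset[of _ "Pow V \<times> Pow V"]) (use V(1) in \<open>auto simp: balanced_cuts_def\<close>)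
  ultimately have phi: "min_balanced_cut V E \<le> card (edges_between E A (V - A))"
    unfolding min_balanced_cut_def by (intro Min_le) (auto intro!: image_eqI[of _ _ "(A, V - A)"])
  have "2 / 3 * card V * min_balanced_cut V E \<le>
      (\<Sum>e\<in>edges_between E A (V - A). 2 / 3 * real (card V))"
    using phi by (simp add: mult.commute mult_left_mono)
  also have "\<dots> \<le> (\<Sum>e\<in>edges_between E A (V - A). real (length (leaf_list (lca_subtree T e))))"
  proof (rule sum_mono)
    fix e assume "e \<in> edges_between E A (V - A)"
    then have "e \<inter> A \<noteq> {}" "\<not> e \<subseteq> A" by (auto simp: edges_between_def)
    then show "2 / 3 * real (card V) \<le> real (length (leaf_list (lca_subtree T e)))"
      using cut by fastforce
  qed
  also have "\<dots> \<le> (\<Sum>e\<in>E. real (length (leaf_list (lca_subtree T e))))"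
    using E(1) by (intro sum_mono2) (auto simp: edges_between_def)
  finally show ?thesis by simp
qed

section \<open>Privacy under toggling one edge\<close>

text \<open>Layer cake: the expectation of \<open>h\<close> is the sum over \<open>t < n\<close> of
  the probabilities of \<open>t < h y\<close>. The domination applies to each of these
  \<open>n\<close> events and loses \<delta> each time.\<close>

lemma expectation_le_of_approx_dominated:
  fixes p q :: "'a pmf" and h :: "'a \<Rightarrow> nat"
  assumes dom: "\<And>Y. measure_pmf.prob p Y \<le> c * measure_pmf.prob q Y + \<delta>"
    and h: "\<And>y. y \<in> set_pmf p \<union> set_pmf q \<Longrightarrow> h y \<le> n"
  shows "measure_pmf.expectation p h \<le> c * measure_pmf.expectation q h + n * \<delta>"
proof -
  have layers: "measure_pmf.expectation r h = (\<Sum>t<n. measure_pmf.prob r {y. t < h y})"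
    if "\<And>y. y \<in> set_pmf r \<Longrightarrow> h y \<le> n" for r :: "'a pmf"
  proof -
    have "real (h y) = (\<Sum>t<n. indicator {y. t < h y} y)" if "h y \<le> n" for y
    proof -
      have "{..<n} \<inter> {t. t < h y} = {..<h y}" using that by auto
      then show ?thesis by (simp add: indicator_def sum.If_cases)
    qed
    then have "measure_pmf.expectation r h =
        measure_pmf.expectation r (\<lambda>y. \<Sum>t<n. indicator {y. t < h y} y)"
      using that by (intro integral_cong_AE) (auto simp: AE_measure_pmf_iff)
    also have "\<dots> = (\<Sum>t<n. measure_pmf.expectation r (indicator {y. t < h y}))"
      by (intro Bochner_Integration.integral_sum) (auto simp: measure_pmf.emeasure_eq_measure)
    finally show ?thesis by simp
  qed
  have "measure_pmf.expectation p h = (\<Sum>t<n. measure_pmf.prob p {y. t < h y})"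
    using h by (intro layers) auto
  also have "\<dots> \<le> (\<Sum>t<n. c * measure_pmf.prob q {y. t < h y} + \<delta>)"
    by (intro sum_mono dom)
  also have "\<dots> = c * measure_pmf.expectation q h + n * \<delta>"
    using h layers[of q] by (simp add: sum.distrib sum_distrib_left)
  finally show ?thesis .
qed

text \<open>Group privacy along a chain of \<open>k\<close> neighbouring inputs. The additive losses
  form a geometric sum, each term of which is bounded by
  \<open>exp (k * \<epsilon>) * \<delta>\<close>.\<close>

lemma prob_chain_le:
  fixes P :: "nat \<Rightarrow> 'b pmf"
  assumes "\<And>j Y. j < k \<Longrightarrow> measure_pmf.prob (P j) Y \<le> exp \<epsilon> * measure_pmf.prob (P (Suc j)) Y + \<delta>"
    and "0 \<le> \<epsilon>" "0 \<le> \<delta>"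
  shows "measure_pmf.prob (P 0) Y \<le> exp (k * \<epsilon>) * measure_pmf.prob (P k) Y + k * (exp (k * \<epsilon>) * \<delta>)"
  using assms(1)
proof (induction k)
  case 0
  then show ?case by simp
next
  case (Suc k)
  have "measure_pmf.prob (P 0) Y \<le> exp (k * \<epsilon>) * measure_pmf.prob (P k) Y + k * (exp (k * \<epsilon>) * \<delta>)"
    using Suc by auto
  also have "\<dots> \<le> exp (k * \<epsilon>) * (exp \<epsilon> * measure_pmf.prob (P (Suc k)) Y + \<delta>) + k * (exp (k * \<epsilon>) * \<delta>)"
    using Suc.prems[of k Y] by (intro add_right_mono mult_left_mono) auto
  also have "\<dots> = exp (Suc k * \<epsilon>) * measure_pmf.prob (P (Suc k)) Y + Suc k * (exp (k * \<epsilon>) * \<delta>)"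
    by (simp add: algebra_simps exp_add)
  also have "\<dots> \<le> exp (Suc k * \<epsilon>) * measure_pmf.prob (P (Suc k)) Y + Suc k * (exp (Suc k * \<epsilon>) * \<delta>)"
    using assms(2,3) by (intro add_left_mono mult_left_mono mult_right_mono) (auto simp: algebra_simps)
  finally show ?case .
qed

text \<open>The weight \<open>k\<close> is a natural number so that toggling one edge takes exactly
  \<open>k\<close> steps of unit size. The restriction to \<open>E\<close> makes the function
  extensional, as \<open>weight_functions\<close> demands.\<close>

definition scaled_indicator :: "'v set set \<Rightarrow> nat \<Rightarrow> 'v set set \<Rightarrow> 'v set \<Rightarrow> real" where
  "scaled_indicator E k S = (\<lambda>e\<in>E. if e \<in> S then real k else 0)"

lemma scaled_indicator_weight: "scaled_indicator E k S \<in> weight_functions E"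
  by (auto simp: scaled_indicator_def weight_functions_def)

lemma differentially_private_insert_edge:
  assumes dp: "differentially_private \<epsilon> \<delta> E \<A>" and E: "finite E" "e \<in> E - S"
    and "0 \<le> \<epsilon>" "0 \<le> \<delta>" and k: "k * \<epsilon> \<le> 1"
  shows "measure_pmf.prob (\<A> (scaled_indicator E k S)) Y
    \<le> exp 1 * measure_pmf.prob (\<A> (scaled_indicator E k (insert e S))) Y + k * (exp 1 * \<delta>)"
proof -
  \<comment> \<open>The weight of \<open>e\<close> rises from \<open>0\<close> to \<open>k\<close>
    by one per step, so consecutive functions have distance exactly 1.\<close>
  define w where "w j = (\<lambda>f\<in>E. if f \<in> S then real k else if f = e then real j else 0)" for j
  have w0: "w 0 = scaled_indicator E k S"
    by (auto simp: w_def scaled_indicator_def)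
  have wk: "w k = scaled_indicator E k (insert e S)"
    by (auto simp: w_def scaled_indicator_def restrict_def)
  have "w j \<in> weight_functions E" for j by (auto simp: w_def weight_functions_def)
  moreover have "neighboring E (w j) (w (Suc j))" for j
  proof -
    have "(\<Sum>f\<in>E. \<bar>w j f - w (Suc j) f\<bar>) = (\<Sum>f\<in>E. if f = e then 1 else 0)"
      using E(2) by (intro sum.cong) (auto simp: w_def)
    then show ?thesis using E by (simp add: neighboring_def)
  qed
  ultimately have step: "measure_pmf.prob (\<A> (w j)) Y
      \<le> exp \<epsilon> * measure_pmf.prob (\<A> (w (Suc j))) Y + \<delta>" for j Y
    using dp unfolding differentially_private_def by blast
  have "measure_pmf.prob (\<A> (w 0)) Y
      \<le> exp (k * \<epsilon>) * measure_pmf.prob (\<A> (w k)) Y + k * (exp (k * \<epsilon>) * \<delta>)"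
    by (rule prob_chain_le[where P = "\<lambda>j. \<A> (w j)"]) (use step assms(4,5) in auto)
  also have "\<dots> \<le> exp 1 * measure_pmf.prob (\<A> (w k)) Y + k * (exp 1 * \<delta>)"
    using k assms(5) by (intro add_mono mult_left_mono mult_right_mono) auto
  finally show ?thesis by (simp only: w0 wk)
qed

section \<open>The lower bound\<close>

lemma dasgupta_cost_scaled_indicator:
  assumes "finite E" "S \<subseteq> E"
  shows "dasgupta_cost E (scaled_indicator E k S) T =
    k * (\<Sum>e\<in>S. real (length (leaf_list (lca_subtree T e))))"
proof -
  have "dasgupta_cost E (scaled_indicator E k S) T =
      (\<Sum>e\<in>E. if e \<in> S then k * real (length (leaf_list (lca_subtree T e))) else 0)"
    unfolding dasgupta_cost_def by (intro sum.cong) (auto simp: scaled_indicator_def)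
  also have "\<dots> = (\<Sum>e\<in>S. k * real (length (leaf_list (lca_subtree T e))))"
    using assms by (simp add: sum.If_cases Int_absorb1)
  finally show ?thesis by (simp add: sum_distrib_left)
qed

text \<open>Clustering by components charges each chosen edge at most \<open>k\<close> times the
  size of its component. Without that edge, the component is covered by the components of the two
  ends, each of mean size at most \<open>K\<close>; this gives \<open>2 * K\<close>, and choosing
  the edge gives the factor \<open>x\<close>.\<close>

lemma mean_optimal_cost_le:
  fixes x K :: real and d :: nat
  assumes V: "finite V" "V \<noteq> {}" and E: "finite E" "\<Union>E \<subseteq> V" "\<And>e. e \<in> E \<Longrightarrow> card e = 2"
    and d: "\<And>v. v \<in> V \<Longrightarrow> card {e\<in>E. v \<in> e} \<le> d"
    and x: "0 \<le> x" and K: "0 \<le> K" "1 + x * d * K \<le> K"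
  shows "(\<Sum>S\<in>Pow E. x ^ card S *
      Min (dasgupta_cost E (scaled_indicator E k S) ` hierarchical_clusterings V))
    \<le> k * (2 * K * x * card E * (1 + x) ^ card E)"
proof -
  have "\<exists>u v. e = {u, v}" if "e \<in> E" for e using E(3)[OF that] by (auto simp: card_2_iff)
  \<comment> \<open>An arbitrary orientation names the two ends of every edge.\<close>
  then obtain a b where ab: "\<And>e. e \<in> E \<Longrightarrow> e = {a e, b e}" by metis
  have abV: "a e \<in> V" "b e \<in> V" if "e \<in> E" for e using ab[OF that] E(2) that by auto
  have opt: "Min (dasgupta_cost E (scaled_indicator E k S) ` hierarchical_clusterings V)
      \<le> k * (\<Sum>e\<in>S. real (card (component S (a e))))" if S: "S \<subseteq> E" for S
  proof -
    have "\<Union>S \<subseteq> V" using S E(2) by auto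
    with V obtain T where T: "T \<in> hierarchical_clusterings V"
      "\<And>u v. u \<in> V \<Longrightarrow> {u, v} \<in> S \<Longrightarrow>
        length (leaf_list (lca_subtree T {u, v})) \<le> card (component S u)"
      by (rule hierarchical_clustering_of_components) blast
    have "length (leaf_list (lca_subtree T e)) \<le> card (component S (a e))" if "e \<in> S" for e
      using T(2)[of "a e" "b e"] ab[of e] abV(1)[of e] that S by auto
    then have "dasgupta_cost E (scaled_indicator E k S) T
        \<le> k * (\<Sum>e\<in>S. real (card (component S (a e))))"
      unfolding dasgupta_cost_scaled_indicator[OF E(1) S] by (intro mult_left_mono sum_mono) auto
    moreover have "Min (dasgupta_cost E (scaled_indicator E k S) ` hierarchical_clusterings V)
        \<le> dasgupta_cost E (scaled_indicator E k S) T"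
      using T(1) finite_hierarchical_clusterings[OF V(1)] by (intro Min_le) auto
    ultimately show ?thesis by linarith
  qed
  have edge: "(\<Sum>S\<in>Pow (E - {e}). x ^ card S * real (card (component (insert e S) (a e))))
      \<le> 2 * K * (1 + x) ^ card E" if e: "e \<in> E" for e
  proof -
    have mean: "(\<Sum>S\<in>Pow (E - {e}). x ^ card S * card (component S u)) \<le> K * (1 + x) ^ card E"
      if "u \<in> V" for u
    proof -
      have "card {f \<in> E - {e}. v \<in> f} \<le> d" if "v \<in> V" for v
      proof -
        have "card {f \<in> E - {e}. v \<in> f} \<le> card {f \<in> E. v \<in> f}"
          using E(1) by (intro card_mono) auto
        then show ?thesis using d[OF that] by linarith
      qed
      then have "(\<Sum>S\<in>Pow (E - {e}). x ^ card S * card (component S u))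
          \<le> K * (1 + x) ^ card (E - {e})"
        using E V x K that by (intro mean_card_component_le[where V = V and d = d]) auto
      also have "\<dots> \<le> K * (1 + x) ^ card E"
        using x K E(1) by (intro mult_left_mono power_increasing card_mono) auto
      finally show ?thesis .
    qed
    have "(\<Sum>S\<in>Pow (E - {e}). x ^ card S * real (card (component (insert e S) (a e))))
        \<le> (\<Sum>S\<in>Pow (E - {e}). x ^ card S *
            (real (card (component S (a e))) + real (card (component S (b e)))))"
    proof (intro sum_mono mult_left_mono)
      fix S assume S: "S \<in> Pow (E - {e})"
      have "component S u \<subseteq> V" if "u \<in> V" for u
        using S E(2) that by (intro component_subset) auto
      then have "finite (component S (a e) \<union> component S (b e))"
        using abV[OF e] V(1) by (auto intro: finite_subset)
      moreover have "component (insert e S) (a e) \<subseteq> component S (a e) \<union> component S (b e)"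
        using component_insert_subset[of "a e" "b e" S] ab[OF e] by simp
      ultimately have "card (component (insert e S) (a e))
          \<le> card (component S (a e)) + card (component S (b e))"
        using card_mono card_Un_le order_trans by metis
      then show "real (card (component (insert e S) (a e)))
          \<le> real (card (component S (a e))) + real (card (component S (b e)))" by linarith
    qed (use x in auto)
    also have "\<dots> \<le> 2 * K * (1 + x) ^ card E"
      using mean[OF abV(1)[OF e]] mean[OF abV(2)[OF e]] by (simp add: distrib_left sum.distrib)
    finally show ?thesis .
  qed
  have "(\<Sum>S\<in>Pow E. x ^ card S *
      Min (dasgupta_cost E (scaled_indicator E k S) ` hierarchical_clusterings V))
    \<le> (\<Sum>S\<in>Pow E. x ^ card S * (k * (\<Sum>e\<in>S. real (card (component S (a e))))))"
    using opt x by (intro sum_mono mult_left_mono) auto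
  also have "\<dots> = k * (\<Sum>S\<in>Pow E. \<Sum>e\<in>S. x ^ card S * real (card (component S (a e))))"
    by (simp add: sum_distrib_left mult.left_commute)
  also have "\<dots> = k * (x * (\<Sum>e\<in>E. \<Sum>S\<in>Pow (E - {e}).
      x ^ card S * real (card (component (insert e S) (a e)))))"
    by (subst sum_Pow_marked[OF E(1), of x "\<lambda>S e. real (card (component S (a e)))"]) simp
  also have "\<dots> \<le> k * (x * (\<Sum>e\<in>E. 2 * K * (1 + x) ^ card E))"
    using edge x by (intro mult_left_mono sum_mono) auto
  finally show ?thesis by (simp add: algebra_simps)
qed

lemma expected_cost_scaled_indicator:
  assumes "hc_algorithm V E \<A>" "finite V" "finite E" "S \<subseteq> E"
  shows "measure_pmf.expectation (\<A> (scaled_indicator E k S)) (dasgupta_cost E (scaled_indicator E k S))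
    = k * (\<Sum>e\<in>S. measure_pmf.expectation (\<A> (scaled_indicator E k S))
        (\<lambda>T. real (length (leaf_list (lca_subtree T e)))))"
proof -
  have "finite (set_pmf (\<A> (scaled_indicator E k S)))"
    using assms(1) finite_hierarchical_clusterings[OF assms(2)] scaled_indicator_weight finite_subset
    unfolding hc_algorithm_def by metis
  then have "integrable (\<A> (scaled_indicator E k S)) f" for f :: "_ \<Rightarrow> real"
    by (rule integrable_measure_pmf_finite)
  moreover have "dasgupta_cost E (scaled_indicator E k S) =
      (\<lambda>T. k * (\<Sum>e\<in>S. real (length (leaf_list (lca_subtree T e)))))"
    using dasgupta_cost_scaled_indicator[OF assms(3,4)] by blast
  ultimately show ?thesis by (simp add: Bochner_Integration.integral_sum)
qed

theorem corollary5p3: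
  fixes V :: "'v set" and E :: "'v set set" and \<epsilon> \<delta> :: real
  assumes "connected_simple_graph V E"
    and "card E > card V"
    and "max_degree V E \<ge> 8"
    and "real (min_balanced_cut V E) \<ge>
      max (8 * real (card V)) (10000 * real (max_degree V E) * log 2 (real (card V)))"
    and "0 < \<epsilon>" and "\<epsilon> \<le> 1"
    and "0 \<le> \<delta>" and "\<delta> \<le> 0.01 * \<epsilon> / real (card E)"
  shows "\<not> (\<exists>\<A> \<eta>. hc_algorithm V E \<A> \<and> differentially_private \<epsilon> \<delta> E \<A> \<and>
      expected_additive_error_le V E \<A> \<eta> \<and>
      \<eta> < real (card V) * real (min_balanced_cut V E) / (400 * \<epsilon> * real (max_degree V E)))"
proof (rule notI, elim exE conjE)
  fix \<A> :: "('v set \<Rightarrow> real) \<Rightarrow> 'v hctree pmf" and \<eta> :: real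
  assume alg: "hc_algorithm V E \<A>" and dp: "differentially_private \<epsilon> \<delta> E \<A>"
    and err: "expected_additive_error_le V E \<A> \<eta>"
    and \<eta>: "\<eta> < real (card V) * real (min_balanced_cut V E) / (400 * \<epsilon> * real (max_degree V E))"
  define d where "d = max_degree V E"
  define m where "m = card E"
  define N where "N = real (card V)"
  define \<Phi> where "\<Phi> = real (min_balanced_cut V E)"
  \<comment> \<open>With \<open>x * d = 1 / 2\<close>, the condition
    \<open>1 + x * d * K \<le> K\<close> holds with equality for \<open>K = 2\<close>.\<close>
  define x where "x = 1 / (2 * real d)"
  define Z where "Z = (1 + x) ^ m"
  define k where "k = nat \<lfloor>1 / \<epsilon>\<rfloor>"
  have V: "finite V" "V \<noteq> {}" and EV: "\<And>e. e \<in> E \<Longrightarrow> e \<subseteq> V" and E2: "\<And>e. e \<in> E \<Longrightarrow> card e = 2"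
    using assms(1) by (auto simp: connected_simple_graph_def)
  have E: "finite E" by (rule finite_subset[of _ "Pow V"]) (use EV V in auto)
  have m: "0 < m" using assms(2) by (simp add: m_def)
  have n2: "2 \<le> card V"
  proof -
    obtain e where "e \<in> E" using m by (auto simp: m_def card_gt_0_iff)
    then show ?thesis using card_mono[OF V(1) EV] E2 by fastforce
  qed
  have d8: "8 \<le> real d" using assms(3) by (simp add: d_def)
  have deg: "card {e\<in>E. v \<in> e} \<le> d" if "v \<in> V" for v
    using that V(1) unfolding d_def max_degree_def degree_def by (intro Max_ge) auto
  \<comment> \<open>Every edge is counted at one of its ends at least, and a vertex lies on at most
    \<open>d\<close> edges.\<close>
  have mN: "real m \<le> N * d"
  proof -
    have "E = (\<Union>v\<in>V. {e\<in>E. v \<in> e})"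
    proof -
      have "\<exists>v\<in>V. v \<in> e" if "e \<in> E" for e
        using EV[OF that] E2[OF that] by (auto simp: card_2_iff)
      then show ?thesis by auto
    qed
    then have "m \<le> (\<Sum>v\<in>V. card {e\<in>E. v \<in> e})"
      using card_UN_le[OF V(1), of "\<lambda>v. {e\<in>E. v \<in> e}"] by (simp add: m_def)
    also have "\<dots> \<le> card V * d" using deg sum_bounded_above[of V _ d] by fastforce
    finally show ?thesis unfolding N_def by (metis of_nat_le_iff of_nat_mult)
  qed
  have x: "0 < x" using d8 by (simp add: x_def)
  have Z: "0 < Z" using x by (simp add: Z_def)
  have N: "2 \<le> N" using n2 by (simp add: N_def)
  have \<Phi>: "10000 * d \<le> \<Phi>"
  proof -
    have "1 \<le> log 2 N" using N by simp
    then have "10000 * real d * 1 \<le> 10000 * real d * log 2 N" by (intro mult_left_mono) auto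
    also have "\<dots> \<le> \<Phi>" using assms(4) by (simp add: d_def N_def \<Phi>_def)
    finally show ?thesis by simp
  qed
  \<comment> \<open>Rounding \<open>1 / \<epsilon>\<close> down loses at most a factor of 2, because
    \<open>1 / \<epsilon>\<close> is at least 1.\<close>
  have k: "k * \<epsilon> \<le> 1" "1 / 2 \<le> k * \<epsilon>"
  proof -
    have "1 \<le> 1 / \<epsilon>" using assms(5,6) by simp
    then have "1 \<le> \<lfloor>1 / \<epsilon>\<rfloor>" by simp
    moreover from this have "real k = \<lfloor>1 / \<epsilon>\<rfloor>"
      unfolding k_def by (intro of_nat_nat) linarith
    ultimately have "real k \<le> 1 / \<epsilon>" "1 / \<epsilon> \<le> 2 * real k" by linarith+
    then show "k * \<epsilon> \<le> 1" "1 / 2 \<le> k * \<epsilon>" using assms(5) by (simp_all add: field_simps)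
  qed
  have kpos: "0 < real k" using k(2) assms(5) by (metis half_gt_zero_iff less_le_trans zero_less_mult_pos2 zero_less_one)

  define f where "f S e = measure_pmf.expectation (\<A> (scaled_indicator E k S))
    (\<lambda>T. real (length (leaf_list (lca_subtree T e))))" for S e
  \<comment> \<open>The slack \<open>k * (exp 1 * \<delta>)\<close> of toggling one edge, once for
    each of the \<open>N\<close> layers of a subtree size.\<close>
  define \<beta> where "\<beta> = N * (k * (exp 1 * \<delta>))"
  define B where "B = (\<Sum>S\<in>Pow E. \<Sum>e\<in>S. x ^ card S * f S e)"
  have supp: "set_pmf (\<A> (scaled_indicator E k S)) \<subseteq> hierarchical_clusterings V" for S
    using alg scaled_indicator_weight unfolding hc_algorithm_def by blast
  have step: "f S e \<le> exp 1 * f (insert e S) e + \<beta>" if "S \<subseteq> E" "e \<in> E - S" for S e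
    unfolding f_def \<beta>_def N_def
  proof (rule expectation_le_of_approx_dominated)
    fix Y show "measure_pmf.prob (\<A> (scaled_indicator E k S)) Y
        \<le> exp 1 * measure_pmf.prob (\<A> (scaled_indicator E k (insert e S))) Y + k * (exp 1 * \<delta>)"
      using that assms(5,7) k(1) by (intro differentially_private_insert_edge[OF dp E]) auto
  next
    fix T assume "T \<in> set_pmf (\<A> (scaled_indicator E k S)) \<union>
        set_pmf (\<A> (scaled_indicator E k (insert e S)))"
    then have "T \<in> hierarchical_clusterings V" using supp by blast
    then show "length (leaf_list (lca_subtree T e)) \<le> card V"
      using length_lca_subtree_le[of T e] by (simp add: length_leaf_list)
  qed
  \<comment> \<open>The bound holds for every tree in the support, hence also for the
    expectation.\<close>
  have total: "2 / 3 * N * \<Phi> \<le> (\<Sum>e\<in>E. f S e)" for S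
  proof -
    have int: "integrable (\<A> (scaled_indicator E k S)) g" for g :: "_ \<Rightarrow> real"
      using supp finite_hierarchical_clusterings[OF V(1)]
      by (intro integrable_measure_pmf_finite) (auto intro: finite_subset)
    have "(\<Sum>e\<in>E. f S e) = measure_pmf.expectation (\<A> (scaled_indicator E k S))
        (\<lambda>T. \<Sum>e\<in>E. real (length (leaf_list (lca_subtree T e))))"
      unfolding f_def using int by (intro Bochner_Integration.integral_sum[symmetric])
    also have "\<dots> \<ge> 2 / 3 * N * \<Phi>"
      unfolding N_def \<Phi>_def using supp sum_length_lca_subtree_ge[OF V(1) n2 E EV]
      by (intro measure_pmf.integral_ge_const int) (auto simp: AE_measure_pmf_iff)
    finally show ?thesis .
  qed
  have "(2 / 3 * N * \<Phi> - card E * \<beta>) * (1 + x) ^ card E \<le> (1 + exp 1 / x) * B"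
    unfolding B_def
    using step total assms(7) N by (intro sum_marked_lower_bound[OF E x]) (auto simp: \<beta>_def)
  then have lower: "(2 / 3 * N * \<Phi> - m * \<beta>) * Z \<le> (1 + exp 1 / x) * B"
    by (simp add: m_def Z_def)

  \<comment> \<open>The quantity \<open>k * B\<close> is the unnormalised mean cost of the
    algorithm. The accuracy assumption bounds it by the mean optimum plus
    \<open>\<eta> * Z\<close>.\<close>
  have "k * B = (\<Sum>S\<in>Pow E. x ^ card S * measure_pmf.expectation (\<A> (scaled_indicator E k S))
      (dasgupta_cost E (scaled_indicator E k S)))"
    by (simp add: B_def f_def expected_cost_scaled_indicator[OF alg V(1) E] sum_distrib_left mult.left_commute)
  also have "\<dots> \<le> (\<Sum>S\<in>Pow E. x ^ card S *
      (Min (dasgupta_cost E (scaled_indicator E k S) ` hierarchical_clusterings V) + \<eta>))"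
    using err scaled_indicator_weight x unfolding expected_additive_error_le_def
    by (intro sum_mono mult_left_mono) auto
  also have "\<dots> = (\<Sum>S\<in>Pow E. x ^ card S *
      Min (dasgupta_cost E (scaled_indicator E k S) ` hierarchical_clusterings V)) + \<eta> * Z"
    using sum_power_card_Pow[OF E, of x]
    by (simp add: distrib_left sum.distrib Z_def m_def flip: sum_distrib_right)
  \<comment> \<open>The first \<open>2\<close> counts the ends of an edge, the second is
    \<open>K\<close>.\<close>
  also have "\<dots> \<le> k * (2 * 2 * x * card E * (1 + x) ^ card E) + \<eta> * Z"
    using V E EV E2 deg x d8
    by (intro add_right_mono mean_optimal_cost_le[where d = d]) (auto simp: x_def)
  also have "\<dots> = (k * (4 * x * m) + \<eta>) * Z" by (simp add: m_def Z_def algebra_simps)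
  finally have upper: "k * B \<le> (k * (4 * x * m) + \<eta>) * Z" .

  have N\<Phi>: "0 < N * \<Phi>" "1 \<le> \<Phi>" using N \<Phi> d8 by auto
  \<comment> \<open>The three inputs are \<open>m * \<delta> \<le> 0.01 * \<epsilon>\<close>,
    \<open>k * \<epsilon> \<le> 1\<close> and \<open>exp 1 \<le> 3\<close>.\<close>
  have "m * \<beta> \<le> 0.03 * N"
  proof -
    have "m * \<delta> \<le> 0.01 * \<epsilon>" using assms(8) m by (simp add: m_def field_simps)
    then have "k * (m * \<delta>) \<le> k * (0.01 * \<epsilon>)" by (intro mult_left_mono) auto
    also have "\<dots> \<le> 0.01" using k(1) by simp
    finally have "exp 1 * (k * (m * \<delta>)) \<le> 3 * 0.01"
      using exp_le assms(7) by (intro mult_mono) auto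
    then have "N * (exp 1 * (k * (m * \<delta>))) \<le> N * (3 * 0.01)"
      using N by (intro mult_left_mono) auto
    then show ?thesis by (simp add: \<beta>_def algebra_simps)
  qed
  also have "\<dots> \<le> 0.03 * (N * \<Phi>)" using N\<Phi> N by simp
  finally have "0.6 * (N * \<Phi>) \<le> 2 / 3 * N * \<Phi> - m * \<beta>" using N\<Phi> by simp
  then have "0.6 * (N * \<Phi>) * Z \<le> (2 / 3 * N * \<Phi> - m * \<beta>) * Z"
    using Z by (intro mult_right_mono) auto
  also note lower
  \<comment> \<open>Here \<open>exp 1 / x\<close> is \<open>2 * exp 1 * d\<close>, at most
    \<open>6 * d\<close>, and the remaining \<open>1\<close> is at most \<open>d\<close>.\<close>
  also have "(1 + exp 1 / x) * B \<le> 7 * d * B"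
  proof (rule mult_right_mono)
    show "0 \<le> B" unfolding B_def f_def using x by (intro sum_nonneg mult_nonneg_nonneg) auto
    have "exp 1 * real d \<le> 3 * real d" using exp_le by (intro mult_right_mono) auto
    moreover have "exp 1 / x = 2 * (exp 1 * real d)" by (simp add: x_def)
    ultimately show "1 + exp 1 / x \<le> 7 * d" using d8 by linarith
  qed
  finally have "k * (0.6 * (N * \<Phi>) * Z) \<le> k * (7 * d * B)"
    using kpos by (intro mult_left_mono) auto
  also have "\<dots> = 7 * d * (k * B)" by simp
  also have "\<dots> \<le> 7 * d * ((k * (4 * x * m) + \<eta>) * Z)"
    using upper by (intro mult_left_mono) auto
  finally have "(k * (0.6 * (N * \<Phi>))) * Z \<le> (7 * d * (k * (4 * x * m) + \<eta>)) * Z"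
    by (simp add: algebra_simps)
  then have "k * (0.6 * (N * \<Phi>)) \<le> 7 * d * (k * (4 * x * m) + \<eta>)"
    using Z by simp
  also have "\<dots> = 14 * (real k * real m) + 7 * d * \<eta>"
    using d8 by (simp add: x_def field_simps)
  \<comment> \<open>The optimum is negligible: \<open>m \<le> N * d\<close> and
    \<open>10000 * d \<le> \<Phi>\<close> leave it at \<open>0.0014 * k * N * \<Phi>\<close>, well
    within the gap between \<open>0.6\<close> and \<open>0.5\<close>.\<close>
  also have "\<dots> \<le> 14 * (real k * (N * \<Phi> / 10000)) + 7 * d * \<eta>"
  proof -
    have "N * (10000 * d) \<le> N * \<Phi>" using \<Phi> N by (intro mult_left_mono) auto
    then have "real m \<le> N * \<Phi> / 10000" using mN by simp
    then show ?thesis by (intro add_right_mono mult_left_mono) auto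
  qed
  finally have "k * (0.6 * (N * \<Phi>)) \<le> 14 * (real k * (N * \<Phi> / 10000)) + 7 * d * \<eta>" .
  moreover have "0 \<le> real k * (N * \<Phi>)" using kpos N\<Phi> by simp
  ultimately have "0.5 * (real k * (N * \<Phi>)) \<le> 7 * d * \<eta>" by (simp add: algebra_simps)
  then have "\<epsilon> * (0.5 * (k * (N * \<Phi>))) \<le> \<epsilon> * (7 * d * \<eta>)"
    using assms(5) by (intro mult_left_mono) auto
  moreover have "1 / 2 * (N * \<Phi>) \<le> k * \<epsilon> * (N * \<Phi>)"
    using k(2) N\<Phi> by (intro mult_right_mono) auto
  \<comment> \<open>The assumed bound on \<eta> makes the right side less than
    \<open>7 / 400\<close> of \<open>N * \<Phi>\<close>, which contradicts the fraction
    \<open>1 / 4\<close>.\<close>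
  ultimately have "1 / 4 * (N * \<Phi>) \<le> 7 * (\<epsilon> * d * \<eta>)" by (simp add: algebra_simps)
  moreover have "400 * (\<epsilon> * d * \<eta>) < N * \<Phi>"
    using \<eta> assms(5) d8 by (simp add: N_def \<Phi>_def d_def field_simps)
  ultimately show False using N\<Phi> by linarith
qed

end
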